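(* Let $\rho,\kappa>-1$ be real numbers, $m\ge0$ an integer and $n$ an integer with $n+\rho\ge0$. When $\rho=0,1,2,\dots$, the point $0$ is a zero of $\mathcal{Z}^{\kappa,\rho}_{m,n}$ if and only if $n>m$, or $m>n$ with $\rho=0$. However, when $\rho$ is non-integer, $0$ is a zero of $\mathcal{Z}^{\kappa,\rho}_{m,n}$ only when $n>m$. The other zeros are the circles centered at the origin with radii $(1+r^{\kappa,\rho}_{m,n})/2$, where $r^{\kappa,\rho}_{m,n}$ are the zeros, located at the segment $(0,1)$, of the real Jacobi polynomial $P_m^{(\kappa,\,n-m+\rho)}(x)$ when $\rho$ is non-integer, and of $P_{m\wedge(n+\rho)}^{(\kappa,\,|n-m+\rho|)}(x)$ when $\rho$ is a nonnegative integer.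
   Context: Let $\mathbb{D}=\{z\in\mathbb{C}:|z|<1\}$ and $\mathbb{D}^*=\mathbb{D}\setminus\{0\}$; $\partial/\partial z$ is the Wirtinger derivative, $(a)_n=a(a+1)\cdots(a+n-1)$, $x\wedge y=\min(x,y)$. For reals $\rho,\kappa>-1$ and integers $m\ge0$, $n$ with $n+\rho\ge0$, the fractional Zernike function on $\mathbb{D}^*$ is $$\mathcal{Z}^{\kappa,\rho}_{m,n}(z,\bar z)=(-1)^m z^{-\rho}(1-|z|^2)^{-\kappa}\frac{\partial^m}{\partial z^m}\Big(z^{n+\rho}(1-|z|^2)^{\kappa+m}\Big),$$ the powers $z^{-\rho}$ and $z^{n+\rho}$ being taken with the same local branch (the result does not depend on the choice). For $a>-1$ and real $b$, $P^{(a,b)}_m$ is the Jacobi polynomial, given by $P^{(a,b)}_m(1-2x)=\frac{(a+1)_m}{m!}\,{}_2F_1(-m,\,m+a+b+1;\,a+1;\,x)$, where ${}_2F_1$ is the Gauss hypergeometric function.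
   Formalization: Radii are corrected from (1+r)/2, r in (0,1), to sqrt((1+r)/2), r in (-1,1) (the printed form fails for κ=ρ=0, m=n=1); "0 is a zero" means a real-analytic extension to 0 with value 0, as mere vanishing of the limit would make the first claim false. *)

theory Defs
  imports "HOL-Analysis.Analysis"
begin

definition wirtinger_dz :: "(complex \<Rightarrow> complex) \<Rightarrow> complex \<Rightarrow> complex" where
  "wirtinger_dz f z =
     (frechet_derivative f (at z) 1 - \<i> * frechet_derivative f (at z) \<i>) / 2"

(* The branch of w^a near p (p nonzero) given by the logarithm w \<mapsto> Ln p + Ln (w / p). It is
   holomorphic on the half-plane Re (w / p) > 0, also when p lies on the cut of Ln, where
   "w powr a" has no derivative. *)
definition local_power :: "complex \<Rightarrow> real \<Rightarrow> complex \<Rightarrow> complex" where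
  "local_power p a w = exp (of_real a * (Ln p + Ln (w / p)))"

(* Both powers use the branch based at the point z of evaluation. Another branch multiplies
   z^(-\<rho>) and z^(n+\<rho>) by exp (-2 \<pi> i k \<rho>) and exp (2 \<pi> i k (n + \<rho>)), whose product is 1. *)
definition frac_zernike :: "real \<Rightarrow> real \<Rightarrow> nat \<Rightarrow> int \<Rightarrow> complex \<Rightarrow> complex" where
  "frac_zernike \<kappa> \<rho> m n z =
     (-1) ^ m * local_power z (- \<rho>) z * of_real ((1 - (cmod z)\<^sup>2) powr (- \<kappa>)) *
     (wirtinger_dz ^^ m)
       (\<lambda>w. local_power z (of_int n + \<rho>) w * of_real ((1 - (cmod w)\<^sup>2) powr (\<kappa> + real m))) z"

(* The hypergeometric series terminates, its first parameter being -m. *)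
definition jacobi_poly :: "nat \<Rightarrow> real \<Rightarrow> real \<Rightarrow> real \<Rightarrow> real" where
  "jacobi_poly m a b x =
     pochhammer (a + 1) m / fact m *
     eval_fps (fps_hypergeo [- real m, real m + a + b + 1] [a + 1] 1) ((1 - x) / 2)"

(* The Zernike functions live on the punctured disc: 0 is a zero of f if f extends real-analytically
   to 0 with value 0. A real-analytic germ at 0 is a power series in z and cnj z converging
   absolutely near 0. A vanishing limit is not enough: (cnj z)^4 / z, which is a special case
   (m = 4, n = -1, \<rho> = 1) up to a nonzero constant, tends to 0 but has the factor 1 / z. *)
definition zero_at_origin :: "(complex \<Rightarrow> complex) \<Rightarrow> bool" where
  "zero_at_origin f \<longleftrightarrow>
     (\<exists>c :: nat \<Rightarrow> nat \<Rightarrow> complex. \<exists>\<epsilon>>0. c 0 0 = 0 \<and>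
        (\<forall>z. 0 < cmod z \<and> cmod z < \<epsilon> \<longrightarrow>
           ((\<lambda>(j, k). c j k * z ^ j * cnj z ^ k) has_sum f z) UNIV))"

(* The zeros in the punctured disc of a function of the form z^l * P(2 * |z|^2 - 1) lie on the
   circles |z| = sqrt ((1 + r) / 2), for r a zero of P in the open orthogonality interval (-1, 1):
   (1 + r) / 2 is the square of the radius. In the source it is printed as the radius itself, with
   r in (0, 1). In that form the claim fails for \<kappa> = \<rho> = 0 and m = n = 1, where the function is
   2 * |z|^2 - 1 and P is the identity, with the single zero r = 0. *)
definition jacobi_circles :: "(real \<Rightarrow> real) \<Rightarrow> complex set" where
  "jacobi_circles P = (\<Union>r \<in> {r. -1 < r \<and> r < 1 \<and> P r = 0}. sphere 0 (sqrt ((1 + r) / 2)))"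

end

theory Submission
  imports Defs
begin

text \<open>
Put \<open>\<alpha> = n + \<rho>\<close> and \<open>t = |z|^2\<close>. Leibniz's rule for the Wirtinger derivative gives the closed form
\<open>m! * z powi (n - m) * R t\<close> of the Zernike function, where \<open>R\<close> is the polynomial
\<open>\<Sum>k\<le>m. (\<kappa> + m gchoose k) * (\<alpha> gchoose (m - k)) * t ^ k * (t - 1) ^ (m - k)\<close>
(\<open>frac_zernike_eq_radial_poly\<close>). A Vandermonde convolution identifies \<open>R t\<close> with the value of the
Jacobi polynomial of degree parameter \<open>m\<close> and parameters \<open>\<kappa>\<close>, \<open>\<alpha> - m\<close> at \<open>2 * t - 1\<close>
(\<open>jacobi_poly_eq_radial_poly\<close>). Away from the origin the power of \<open>z\<close> has no zeros, so the zeros are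
the circles on which \<open>R\<close> vanishes. If \<open>\<alpha>\<close> is a natural number \<open>N < m\<close>, then \<open>R\<close> is a nonzero multiple
of \<open>t ^ (m - N)\<close> times the corresponding polynomial with \<open>m\<close> and \<open>N\<close> exchanged
(\<open>radial_poly_factor\<close>), whence the minimum and the absolute value in the statement.

At the origin everything depends on which powers of \<open>z\<close> and \<open>cnj z\<close> remain. For \<open>n > m\<close> the closed
form is a polynomial in \<open>z\<close> and \<open>cnj z\<close> without constant term. For \<open>n \<le> m\<close> the value
\<open>R 0 = \<plusminus> (\<alpha> gchoose m)\<close> decides. If it is nonzero, the function tends to a nonzero limit
(\<open>n = m\<close>) or is unbounded (\<open>n < m\<close>). It is zero exactly if \<open>\<alpha>\<close> is a natural number \<open>N < m\<close>, which
occurs only for integral \<open>\<rho>\<close>. Then the factor \<open>t ^ (m - N)\<close> leaves \<open>cnj z ^ (m - N) / z ^ \<rho>\<close> times a radial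
polynomial that is nonzero at \<open>0\<close>. For \<open>\<rho> = 0\<close> this is a polynomial in \<open>z\<close> and \<open>cnj z\<close> with a
zero at the origin; for \<open>\<rho> \<ge> 1\<close> it may be bounded, but it has no real-analytic extension. All the
negative claims follow from \<open>zero_at_origin_imp_radial_zero\<close>, an averaging argument over rotations.
\<close>

section \<open>Iterated Wirtinger derivatives\<close>

lemma wirtinger_dz_eq:
  assumes "(f has_derivative D) (at w)"
  shows "wirtinger_dz f w = (D 1 - \<i> * D \<i>) / 2"
  using frechet_derivative_at[OF assms] by (simp add: wirtinger_dz_def)

text \<open>
The Wirtinger derivative maps linear combinations of these functions to linear combinations of
these functions: it lowers the exponent of the holomorphic power, or it lowers that of the radial
factor and produces a factor \<^term>\<open>cnj w\<close>.
\<close>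

definition zernike_monomial :: "complex \<Rightarrow> real \<Rightarrow> real \<Rightarrow> nat \<Rightarrow> complex \<Rightarrow> complex" where
  "zernike_monomial p s q j w = local_power p s w * cnj w ^ j * of_real ((1 - (cmod w)\<^sup>2) powr q)"

text \<open>
An open set on which the branch based at \<^term>\<open>p\<close> is holomorphic and the radial factor is smooth.
Iterating the derivative requires formulas on such a set, not only at \<^term>\<open>p\<close>.
\<close>

definition branch_domain :: "complex \<Rightarrow> complex set" where
  "branch_domain p = {w. cmod w < 1 \<and> 0 < Re (w / p)}"

lemma open_branch_domain: "open (branch_domain p)"
  unfolding branch_domain_def divide_inverse
  by (intro open_Collect_conj open_Collect_less continuous_intros)

lemma local_power_has_field_derivative:
  assumes "0 < Re (w / p)"
  shows "(local_power p s has_field_derivative of_real s * local_power p (s - 1) w) (at w)"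
proof -
  have p: "p \<noteq> 0" and w: "w \<noteq> 0" using assms by auto
  have "w / p \<notin> \<real>\<^sub>\<le>\<^sub>0" using assms by (auto simp: complex_nonpos_Reals_iff)
  then have "(local_power p s has_field_derivative local_power p s w * (of_real s / w)) (at w)"
    unfolding local_power_def using p w by (auto intro!: derivative_eq_intros)
  moreover have "local_power p s w = local_power p (s - 1) w * w"
  proof -
    have "exp (Ln p + Ln (w / p)) = w"
      using p w by (simp add: exp_add)
    moreover have "of_real s * (Ln p + Ln (w / p)) =
        of_real (s - 1) * (Ln p + Ln (w / p)) + (Ln p + Ln (w / p))"
      by (simp add: algebra_simps)
    ultimately show ?thesis unfolding local_power_def by (metis exp_add)
  qed
  ultimately show ?thesis using w by (simp add: field_simps)
qed

lemma zernike_monomial_has_derivative: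
  assumes "w \<in> branch_domain p"
  obtains D where "(zernike_monomial p s q j has_derivative D) (at w)"
    and "(D 1 - \<i> * D \<i>) / 2 =
      of_real s * zernike_monomial p (s - 1) q j w - of_real q * zernike_monomial p s (q - 1) (Suc j) w"
proof
  define L L' where "L = local_power p s w" and "L' = of_real s * local_power p (s - 1) w"
  define r where "r = 1 - (cmod w)\<^sup>2"
  have r: "r > 0" and re: "0 < Re (w / p)"
    using assms by (auto simp: branch_domain_def r_def power_less_one_iff abs_square_less_1)
  have dL: "(local_power p s has_derivative (\<lambda>h. L' * h)) (at w)"
    using local_power_has_field_derivative[OF re, of s]
    by (simp add: has_field_derivative_def L'_def)
  have dR: "((\<lambda>w. 1 - (cmod w)\<^sup>2) has_derivative (\<lambda>h. - 2 * (w \<bullet> h))) (at w)"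
    unfolding power2_norm_eq_inner by (auto intro!: derivative_eq_intros simp: inner_commute)
  have dP: "((\<lambda>w. (1 - (cmod w)\<^sup>2) powr q) has_derivative
      (\<lambda>h. q * r powr (q - 1) * (- 2 * (w \<bullet> h)))) (at w)"
    using r by (auto intro!: derivative_eq_intros dR simp: r_def powr_diff field_simps)
  have dC: "((\<lambda>w. cnj w ^ j) has_derivative (\<lambda>h. of_nat j * cnj w ^ (j - 1) * cnj h)) (at w)"
    by (auto intro!: derivative_eq_intros simp: mult_ac)
  let ?D = "\<lambda>h. (L * cnj w ^ j) * of_real (q * r powr (q - 1) * (- 2 * (w \<bullet> h))) +
     (L * (of_nat j * cnj w ^ (j - 1) * cnj h) + L' * h * cnj w ^ j) * of_real (r powr q)"
  show "(zernike_monomial p s q j has_derivative ?D) (at w)"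
    unfolding zernike_monomial_def[abs_def]
    using has_derivative_mult[OF has_derivative_mult[OF dL dC] has_derivative_of_real[OF dP]]
    unfolding L_def r_def .
  have "w \<bullet> 1 = Re w" "w \<bullet> \<i> = Im w" by (auto simp: inner_complex_def)
  \<comment> \<open>the antiholomorphic factor drops out because cnj 1 - \<i> * cnj \<i> = 0\<close>
  then show "(?D 1 - \<i> * ?D \<i>) / 2 =
      of_real s * zernike_monomial p (s - 1) q j w - of_real q * zernike_monomial p s (q - 1) (Suc j) w"
    unfolding zernike_monomial_def r_def[symmetric] L_def[symmetric]
    by (simp add: L'_def complex_eq_iff field_simps)
qed

lemma wirtinger_dz_sum:
  assumes "finite K" "w \<in> branch_domain p"
    and "\<And>v. v \<in> branch_domain p \<Longrightarrow>
      f v = (\<Sum>k\<in>K. of_real (c k) * zernike_monomial p (s k) (q k) (j k) v)"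
  shows "wirtinger_dz f w = (\<Sum>k\<in>K. of_real (c k) *
    (of_real (s k) * zernike_monomial p (s k - 1) (q k) (j k) w -
     of_real (q k) * zernike_monomial p (s k) (q k - 1) (Suc (j k)) w))"
proof -
  have "\<exists>D. (zernike_monomial p (s k) (q k) (j k) has_derivative D) (at w) \<and>
     (D 1 - \<i> * D \<i>) / 2 = of_real (s k) * zernike_monomial p (s k - 1) (q k) (j k) w
        - of_real (q k) * zernike_monomial p (s k) (q k - 1) (Suc (j k)) w" for k
    using zernike_monomial_has_derivative[OF assms(2)] by metis
  then obtain D where D: "\<And>k. (zernike_monomial p (s k) (q k) (j k) has_derivative D k) (at w)"
    and D': "\<And>k. (D k 1 - \<i> * D k \<i>) / 2 = of_real (s k) * zernike_monomial p (s k - 1) (q k) (j k) w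
        - of_real (q k) * zernike_monomial p (s k) (q k - 1) (Suc (j k)) w"
    by metis
  have "((\<lambda>v. \<Sum>k\<in>K. of_real (c k) * zernike_monomial p (s k) (q k) (j k) v) has_derivative
      (\<lambda>h. \<Sum>k\<in>K. of_real (c k) * D k h)) (at w)"
    by (intro has_derivative_sum has_derivative_mult_right D)
  then have "(f has_derivative (\<lambda>h. \<Sum>k\<in>K. of_real (c k) * D k h)) (at w)"
    using has_derivative_transform_within_open[OF _ open_branch_domain assms(2)] assms(3)
    by (metis (no_types, lifting))
  then have "wirtinger_dz f w =
      ((\<Sum>k\<in>K. of_real (c k) * D k 1) - \<i> * (\<Sum>k\<in>K. of_real (c k) * D k \<i>)) / 2"
    by (rule wirtinger_dz_eq)
  also have "\<dots> = (\<Sum>k\<in>K. of_real (c k) * ((D k 1 - \<i> * D k \<i>) / 2))"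
    by (simp add: sum_distrib_left sum_subtractf sum_divide_distrib algebra_simps diff_divide_distrib)
  finally show ?thesis by (simp add: D')
qed

text \<open>
Leibniz rule for the holomorphic power times the radial factor. With generalised binomial
coefficients the product of the ordinary binomial coefficient and the two falling factorials becomes
\<^term>\<open>fact i\<close> times a product of two binomials, and the induction step reduces to
\<^term>\<open>(x - real k) * (x gchoose k) = real (Suc k) * (x gchoose Suc k)\<close> for both.
\<close>

lemma wirtinger_dz_funpow_zernike_monomial:
  assumes "w \<in> branch_domain p"
  shows "(wirtinger_dz ^^ i) (zernike_monomial p s q 0) w =
    (\<Sum>k\<le>i. of_real (fact i * (s gchoose (i - k)) * (q gchoose k) * (-1) ^ k) *
       zernike_monomial p (s - real i + real k) (q - real k) k w)"
  using assms
proof (induction i arbitrary: w)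
  case 0
  then show ?case by simp
next
  case (Suc i)
  define A B where "A k = s gchoose k" and "B k = q gchoose k" for k
  define Z where "Z k = zernike_monomial p (s - real (Suc i) + real k) (q - real k) k w" for k
  define u where "u k = of_real (fact i * (-1) ^ k * A (Suc i - k) * B k) * Z k" for k
  have A: "A k * (s - real k) = real (Suc k) * A (Suc k)" for k
    unfolding A_def using gbinomial_mult_1[of s k] by (simp add: algebra_simps)
  have B: "B k * (q - real k) = real (Suc k) * B (Suc k)" for k
    unfolding B_def using gbinomial_mult_1[of q k] by (simp add: algebra_simps)
  have "(wirtinger_dz ^^ Suc i) (zernike_monomial p s q 0) w =
    (\<Sum>k\<le>i. of_real (fact i * A (i - k) * B k * (-1) ^ k) *
      (of_real (s - real i + real k) * zernike_monomial p (s - real i + real k - 1) (q - real k) k w -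
       of_real (q - real k) * zernike_monomial p (s - real i + real k) (q - real k - 1) (Suc k) w))"
    unfolding A_def B_def funpow.simps o_apply
    by (rule wirtinger_dz_sum) (use Suc in auto)
  \<comment> \<open>each term splits into a part with the indices of u k and one with those of u (Suc k)\<close>
  also have "\<dots> = (\<Sum>k\<le>i. of_nat (Suc i - k) * u k + of_nat (Suc k) * u (Suc k))"
  proof (intro sum.cong refl)
    fix k assume k: "k \<in> {..i}"
    have a: "(s - real i + real k) * A (i - k) = real (Suc i - k) * A (Suc i - k)"
      using A[of "i - k"] k by (simp add: of_nat_diff Suc_diff_le algebra_simps)
    have za: "zernike_monomial p (s - real i + real k - 1) (q - real k) k w = Z k"
      and zb: "zernike_monomial p (s - real i + real k) (q - real k - 1) (Suc k) w = Z (Suc k)"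
      by (simp_all add: Z_def algebra_simps)
    have "of_real (fact i * A (i - k) * B k * (-1) ^ k) * of_real (s - real i + real k) * Z k =
        of_nat (Suc i - k) * u k"
    proof -
      have "fact i * A (i - k) * B k * (-1) ^ k * (s - real i + real k) =
         fact i * B k * (-1) ^ k * ((s - real i + real k) * A (i - k))" by simp
      also have "\<dots> = real (Suc i - k) * (fact i * (-1) ^ k * A (Suc i - k) * B k)"
        unfolding a by simp
      finally have "fact i * A (i - k) * B k * (-1) ^ k * (s - real i + real k) =
         real (Suc i - k) * (fact i * (-1) ^ k * A (Suc i - k) * B k)" .
      from arg_cong[OF this, of "\<lambda>x. complex_of_real x * Z k"] show ?thesis
        by (simp only: u_def of_real_mult of_real_of_nat_eq mult.assoc)
    qed
    moreover have "of_real (fact i * A (i - k) * B k * (-1) ^ k) * of_real (q - real k) * Z (Suc k) =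
        - of_nat (Suc k) * u (Suc k)"
    proof -
      have "fact i * A (i - k) * B k * (-1) ^ k * (q - real k) =
         fact i * A (i - k) * (-1) ^ k * (B k * (q - real k))" by simp
      also have "\<dots> = - (real (Suc k) * (fact i * (-1) ^ Suc k * A (Suc i - Suc k) * B (Suc k)))"
        unfolding B by simp
      finally have "fact i * A (i - k) * B k * (-1) ^ k * (q - real k) =
         - (real (Suc k) * (fact i * (-1) ^ Suc k * A (Suc i - Suc k) * B (Suc k)))" .
      from arg_cong[OF this, of "\<lambda>x. complex_of_real x * Z (Suc k)"] show ?thesis
        by (simp only: u_def of_real_mult of_real_minus of_real_of_nat_eq mult_minus_left mult.assoc)
    qed
    ultimately show "of_real (fact i * A (i - k) * B k * (-1) ^ k) *
      (of_real (s - real i + real k) * zernike_monomial p (s - real i + real k - 1) (q - real k) k w -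
       of_real (q - real k) * zernike_monomial p (s - real i + real k) (q - real k - 1) (Suc k) w) =
       of_nat (Suc i - k) * u k + of_nat (Suc k) * u (Suc k)"
      unfolding za zb by (simp only: right_diff_distrib mult.assoc[symmetric]) (simp add: algebra_simps)
  qed
  \<comment> \<open>the term added to each sum has a zero factor: Suc i - k at k = Suc i, and k at k = 0\<close>
  also have "\<dots> = (\<Sum>k\<le>Suc i. of_nat (Suc i - k) * u k) + (\<Sum>k\<le>Suc i. of_nat k * u k)"
  proof -
    have "(\<Sum>k\<le>Suc i. of_nat k * u k) = (\<Sum>k\<le>i. of_nat (Suc k) * u (Suc k))"
      by (subst sum.atMost_Suc_shift) simp
    then show ?thesis by (simp only: sum.distrib sum.atMost_Suc) simp
  qed
  also have "\<dots> = (\<Sum>k\<le>Suc i. of_nat (Suc i) * u k)"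
    unfolding sum.distrib[symmetric]
    by (intro sum.cong refl) (simp add: of_nat_diff algebra_simps)
  finally show ?case
    by (simp add: u_def Z_def A_def B_def mult_ac)
qed

section \<open>The radial factor as a Jacobi polynomial\<close>

text \<open>
The form of the Jacobi polynomial that Leibniz's rule produces: in the variable \<open>t = (1 + x) / 2\<close>
it is the expansion that Rodrigues' formula gives for the parameters \<^term>\<open>a\<close> and \<open>\<alpha> - m\<close>.
\<close>

definition radial_poly :: "nat \<Rightarrow> real \<Rightarrow> real \<Rightarrow> real poly" where
  "radial_poly m a \<alpha> = (\<Sum>k\<le>m. smult (((a + real m) gchoose k) * (\<alpha> gchoose (m - k)))
     ([:0, 1:] ^ k * [:-1, 1:] ^ (m - k)))"

lemma poly_radial_poly:
  "poly (radial_poly m a \<alpha>) t =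
     (\<Sum>k\<le>m. ((a + real m) gchoose k) * (\<alpha> gchoose (m - k)) * t ^ k * (t - 1) ^ (m - k))"
  unfolding radial_poly_def poly_sum by (intro sum.cong) (auto simp: mult.assoc)

lemma poly_radial_poly_0: "poly (radial_poly m a \<alpha>) 0 = (-1) ^ m * (\<alpha> gchoose m)"
proof -
  have "poly (radial_poly m a \<alpha>) 0 =
      (\<Sum>k\<le>m. if k = 0 then (\<alpha> gchoose m) * (- 1) ^ m else 0)"
    unfolding poly_radial_poly by (intro sum.cong) auto
  then show ?thesis by simp
qed

lemma power_mult_diff_1_power:
  fixes t :: real
  assumes "k \<le> m"
  shows "t ^ k * (t - 1) ^ (m - k) = (\<Sum>p\<le>m. real (k choose p) * (t - 1) ^ (m - p))"
proof -
  have "t ^ k = (1 + (t - 1)) ^ k" by simp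
  also have "\<dots> = (\<Sum>p\<le>k. real (k choose p) * (t - 1) ^ (k - p))"
    by (subst binomial_ring) simp
  finally have "t ^ k * (t - 1) ^ (m - k) =
      (\<Sum>p\<le>k. real (k choose p) * ((t - 1) ^ (k - p) * (t - 1) ^ (m - k)))"
    by (simp add: sum_distrib_right mult.assoc)
  also have "\<dots> = (\<Sum>p\<le>k. real (k choose p) * (t - 1) ^ (m - p))"
    using assms by (intro sum.cong) (auto simp flip: power_add)
  also have "\<dots> = (\<Sum>p\<le>m. real (k choose p) * (t - 1) ^ (m - p))"
    using assms by (intro sum.mono_neutral_left) auto
  finally show ?thesis .
qed

text \<open>
Re-expansion in powers of \<open>t - 1\<close>. After the binomial theorem for \<open>t ^ k = (1 + (t - 1)) ^ k\<close>, the
coefficient is a sum over \<open>k\<close> to which trinomial revision and then the Vandermonde convolution apply.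
\<close>

lemma poly_radial_poly_expand:
  "poly (radial_poly m a \<alpha>) t =
     (\<Sum>p\<le>m. ((a + real m) gchoose p) * ((a + \<alpha> + real (m - p)) gchoose (m - p)) * (t - 1) ^ (m - p))"
proof -
  have inner: "(\<Sum>k\<le>m. ((a + real m) gchoose k) * (\<alpha> gchoose (m - k)) * real (k choose p)) =
      ((a + real m) gchoose p) * ((a + \<alpha> + real (m - p)) gchoose (m - p))" if p: "p \<le> m" for p
  proof -
    have "(\<Sum>k\<le>m. ((a + real m) gchoose k) * (\<alpha> gchoose (m - k)) * real (k choose p)) =
        (\<Sum>k\<in>{p..m}. ((a + real m) gchoose k) * (\<alpha> gchoose (m - k)) * real (k choose p))"
      by (intro sum.mono_neutral_right) auto
    also have "\<dots> = (\<Sum>k\<in>{p..m}. ((a + real m) gchoose p) *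
        (((a + real (m - p)) gchoose (k - p)) * (\<alpha> gchoose (m - k))))"
    proof (intro sum.cong refl)
      fix k assume k: "k \<in> {p..m}"
      have "((a + real m) gchoose k) * real (k choose p) =
          ((a + real m) gchoose p) * ((a + real m - real p) gchoose (k - p))"
        using gbinomial_trinomial_revision[of p k "a + real m"] k by (simp add: binomial_gbinomial)
      then show "((a + real m) gchoose k) * (\<alpha> gchoose (m - k)) * real (k choose p) =
          ((a + real m) gchoose p) * (((a + real (m - p)) gchoose (k - p)) * (\<alpha> gchoose (m - k)))"
        using p by (simp add: of_nat_diff algebra_simps)
    qed
    also have "\<dots> = ((a + real m) gchoose p) *
        (\<Sum>k\<in>{p..m}. ((a + real (m - p)) gchoose (k - p)) * (\<alpha> gchoose (m - k)))"
      by (simp add: sum_distrib_left)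
    also have "(\<Sum>k\<in>{p..m}. ((a + real (m - p)) gchoose (k - p)) * (\<alpha> gchoose (m - k))) =
        (\<Sum>i\<in>{0..m-p}. ((a + real (m - p)) gchoose i) * (\<alpha> gchoose (m - p - i)))"
      using p by (intro sum.reindex_bij_witness[of _ "\<lambda>i. i + p" "\<lambda>k. k - p"]) auto
    also have "\<dots> = (a + real (m - p) + \<alpha>) gchoose (m - p)"
      by (rule gbinomial_Vandermonde)
    finally show ?thesis by (simp add: algebra_simps)
  qed
  have "poly (radial_poly m a \<alpha>) t = (\<Sum>k\<le>m. \<Sum>p\<le>m.
      ((a + real m) gchoose k) * (\<alpha> gchoose (m - k)) * real (k choose p) * (t - 1) ^ (m - p))"
    unfolding poly_radial_poly
    by (intro sum.cong refl) (simp add: power_mult_diff_1_power mult.assoc sum_distrib_left)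
  also have "\<dots> = (\<Sum>p\<le>m. (\<Sum>k\<le>m. ((a + real m) gchoose k) * (\<alpha> gchoose (m - k)) *
      real (k choose p)) * (t - 1) ^ (m - p))"
    by (subst sum.swap) (simp add: sum_distrib_right)
  finally show ?thesis by (simp add: inner)
qed

text \<open>
The coefficients of the expansion at \<open>t = 1\<close> are those of the hypergeometric series, whose argument
\<open>(1 - x) / 2\<close> is \<open>1 - t\<close>. The bound on \<^term>\<open>a\<close> keeps the denominators
\<^term>\<open>pochhammer (a + 1) j\<close> away from zero.
\<close>

lemma jacobi_poly_eq_radial_poly:
  assumes "a > -1"
  shows "jacobi_poly m a (\<alpha> - real m) (2 * t - 1) = poly (radial_poly m a \<alpha>) t"
proof -
  define F where "F = fps_hypergeo [- real m, real m + a + (\<alpha> - real m) + 1] [a + 1] 1"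
  have F: "fps_nth F j = pochhammer (- real m) j * pochhammer (a + \<alpha> + 1) j /
      (pochhammer (a + 1) j * fact j)" for j
    by (simp add: F_def algebra_simps)
  have poch: "pochhammer (- real m) j = (-1) ^ j * fact m / fact (m - j)" if "j \<le> m" for j
  proof -
    have "pochhammer (- real m) j = (-1) ^ j * fact j * (real m gchoose j)"
      by (simp add: gbinomial_pochhammer)
    also have "real m gchoose j = fact m / (fact j * fact (m - j))"
      using that by (simp add: binomial_fact flip: binomial_gbinomial)
    finally show ?thesis by simp
  qed
  have pos: "pochhammer (a + 1) j > 0" for j
    using assms by (intro pochhammer_pos) auto
  have coeff: "pochhammer (a + 1) m / fact m * (fps_nth F j * (1 - t) ^ j) =
      ((a + real m) gchoose (m - j)) * ((a + \<alpha> + real j) gchoose j) * (t - 1) ^ j" if "j \<le> m" for j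
  proof -
    have "pochhammer (a + 1) m = pochhammer (a + 1) j * pochhammer (a + 1 + real j) (m - j)"
      using that by (rule pochhammer_product)
    moreover have "(1 - t) ^ j = (-1) ^ j * (t - 1) ^ j"
      by (simp flip: power_mult_distrib)
    ultimately show ?thesis
      using that pos[of j]
      by (simp add: F poch gbinomial_pochhammer' of_nat_diff algebra_simps flip: power_mult_distrib)
  qed
  have "eval_fps F (1 - t) = (\<Sum>j\<le>m. fps_nth F j * (1 - t) ^ j)"
    \<comment> \<open>the series terminates because (-m)_j = 0 for j > m\<close>
    unfolding eval_fps_def by (intro suminf_finite) (auto simp: F pochhammer_of_nat_eq_0_iff)
  moreover have "jacobi_poly m a (\<alpha> - real m) (2 * t - 1) =
      pochhammer (a + 1) m / fact m * eval_fps F (1 - t)"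
  proof -
    have arg: "(1 - (2 * t - 1)) / 2 = 1 - t" by (simp add: field_simps)
    show ?thesis unfolding jacobi_poly_def F_def arg ..
  qed
  ultimately have "jacobi_poly m a (\<alpha> - real m) (2 * t - 1) =
      (\<Sum>j\<le>m. pochhammer (a + 1) m / fact m * (fps_nth F j * (1 - t) ^ j))"
    by (simp add: sum_distrib_left)
  also have "\<dots> = (\<Sum>j\<le>m. ((a + real m) gchoose (m - j)) * ((a + \<alpha> + real j) gchoose j) * (t - 1) ^ j)"
    by (intro sum.cong refl coeff) auto
  also have "\<dots> = poly (radial_poly m a \<alpha>) t"
    unfolding poly_radial_poly_expand
    by (intro sum.reindex_bij_witness[of _ "\<lambda>p. m - p" "\<lambda>j. m - j"]) auto
  finally show ?thesis .
qed

text \<open>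
For a natural number \<open>\<alpha> = N\<close> below \<open>m\<close> the second Jacobi parameter \<open>N - m\<close> is negative. The binomials
\<open>N gchoose (m - k)\<close> then vanish for \<open>k < m - N\<close>, so a power of \<open>t\<close> splits off; what is left is the
polynomial with the roles of \<open>N\<close> and \<open>m\<close> exchanged, hence with second parameter \<open>m - N\<close>.
\<close>

lemma radial_poly_factor:
  assumes "a > -1" "N \<le> m"
  obtains c where "c \<noteq> 0"
    and "\<And>t. poly (radial_poly m a (real N)) t = c * t ^ (m - N) * poly (radial_poly N a (real m)) t"
proof
  define d where "d = m - N"
  have m: "m = N + d" using assms by (simp add: d_def)
  define X where "X = pochhammer (a + real N + 1) d"
  define c where "c = X * fact N / fact m"
  have "pochhammer (a + real N + 1) d > 0"
    using assms by (intro pochhammer_pos) auto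
  then show "c \<noteq> 0" by (simp add: c_def X_def)
  have coeff: "((a + real m) gchoose (d + i)) * (real N gchoose (N - i)) =
      c * (((a + real N) gchoose i) * (real m gchoose (N - i)))" if "i \<le> N" for i
  proof -
    have "pochhammer (a + real N - real i + 1) (i + d) =
        pochhammer (a + real N - real i + 1) i * X"
    proof -
      have "a + real N + 1 = a + real N - real i + 1 + real i" by simp
      then show ?thesis unfolding X_def by (simp only: pochhammer_product')
    qed
    moreover have "real N gchoose (N - i) = fact N / (fact (N - i) * fact i)"
      using that by (simp add: binomial_fact flip: binomial_gbinomial)
    moreover have "real m gchoose (N - i) = fact m / (fact (N - i) * fact (i + d))"
    proof -
      have "real (m choose (N - i)) = fact m / (fact (N - i) * fact (m - (N - i)))"
        using that m by (intro binomial_fact) auto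
      also have "m - (N - i) = i + d" using that m by auto
      finally show ?thesis by (simp only: binomial_gbinomial)
    qed
    ultimately show ?thesis
      by (simp add: gbinomial_pochhammer' c_def m add_ac add_diff_eq diff_add_eq mult_ac)
  qed
  fix t :: real
  \<comment> \<open>the terms with k < d vanish because N choose (m - k) = 0\<close>
  have "poly (radial_poly m a (real N)) t = (\<Sum>k\<in>{d..m}. ((a + real m) gchoose k) *
      (real N gchoose (m - k)) * t ^ k * (t - 1) ^ (m - k))"
    unfolding poly_radial_poly
    by (intro sum.mono_neutral_right) (auto simp: m simp flip: binomial_gbinomial)
  also have "\<dots> = (\<Sum>i\<le>N. ((a + real m) gchoose (d + i)) *
      (real N gchoose (N - i)) * t ^ (d + i) * (t - 1) ^ (N - i))"
    by (intro sum.reindex_bij_witness[of _ "\<lambda>i. d + i" "\<lambda>k. k - d"]) (auto simp: m)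
  also have "\<dots> = c * t ^ d * poly (radial_poly N a (real m)) t"
    unfolding poly_radial_poly sum_distrib_left
    by (intro sum.cong refl) (simp add: coeff power_add)
  finally show "poly (radial_poly m a (real N)) t =
      c * t ^ (m - N) * poly (radial_poly N a (real m)) t" by (simp add: d_def)
qed

section \<open>Zeros at the origin\<close>

lemma has_sum_finite_sum:
  fixes f :: "'i \<Rightarrow> 'a \<Rightarrow> complex"
  assumes "finite I" "\<And>i. i \<in> I \<Longrightarrow> (f i has_sum s i) A"
  shows "((\<lambda>x. \<Sum>i\<in>I. f i x) has_sum (\<Sum>i\<in>I. s i)) A"
  using assms by (induction I rule: finite_induct) (auto intro: has_sum_add has_sum_0)

lemma sum_roots_of_unity_power:
  assumes "0 < e" "e < L"
  shows "(\<Sum>i<L. cis (2 * pi * real i / real L) ^ e) = 0"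
proof -
  define \<zeta> where "\<zeta> = cis (2 * pi * real e / real L)"
  have "inj_on (\<lambda>k. cis (2 * pi * real k / real L)) {..<L}"
    using Complex.bij_betw_roots_unity[of L] assms by (auto simp: bij_betw_def)
  then have "\<zeta> \<noteq> cis (2 * pi * real 0 / real L)"
    unfolding \<zeta>_def using assms by (subst inj_on_eq_iff) auto
  then have "\<zeta> \<noteq> 1" by simp
  have "real L * (2 * pi * real e / real L) = 2 * pi * real e"
    using assms by simp
  then have "\<zeta> ^ L = 1"
    unfolding \<zeta>_def Complex.DeMoivre by (simp only: cis_multiple_2pi Ints_of_nat)
  have "(\<Sum>i<L. cis (2 * pi * real i / real L) ^ e) = (\<Sum>i<L. \<zeta> ^ i)"
    by (intro sum.cong refl) (simp add: \<zeta>_def Complex.DeMoivre mult_ac)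
  also have "\<dots> = 0" using \<open>\<zeta> \<noteq> 1\<close> \<open>\<zeta> ^ L = 1\<close> by (simp add: geometric_sum)
  finally show ?thesis .
qed

text \<open>
A function \<open>cnj z ^ b / z ^ a * S (|z|^2)\<close> with a true pole factor (or with \<open>a = b = 0\<close>) and
\<^term>\<open>S 0 \<noteq> 0\<close> does not have a zero at the origin. Under rotations it transforms by a character
of order \<open>- (a + b)\<close>, so it is unchanged by the corresponding weighted average over roots of unity.
The same average removes from a power series in \<open>z\<close> and \<open>cnj z\<close> every term of total
degree at most \<open>b - a\<close>: for \<open>a > 0\<close> such a term has order \<open>j - k\<close> greater than \<open>- (a + b)\<close>, and for
\<open>a = b = 0\<close> it is the constant term, which is zero from the start. If \<open>b \<ge> a\<close>, what is left is
\<open>O (r ^ (b - a + 1))\<close> on the circle of radius \<open>r\<close>, while the function itself has modulus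
\<open>r ^ (b - a) * |S (r^2)|\<close> there, which forces \<open>S\<close> to vanish at \<open>0\<close>.
If \<open>b < a\<close>, boundedness of the power series has the same effect.
\<close>

lemma zero_at_origin_imp_radial_zero:
  assumes zero: "zero_at_origin f" and "\<delta> > 0" and S: "isCont S 0"
    and f: "\<And>z. 0 < cmod z \<Longrightarrow> cmod z < \<delta> \<Longrightarrow> f z = cnj z ^ b / z ^ a * of_real (S ((cmod z)\<^sup>2))"
    and ab: "a = 0 \<Longrightarrow> b = 0"
  shows "S 0 = 0"
proof -
  obtain c \<epsilon> where c0: "c 0 0 = 0" and "\<epsilon> > 0"
    and c: "\<And>z. 0 < cmod z \<Longrightarrow> cmod z < \<epsilon> \<Longrightarrow>
          ((\<lambda>(j, k). c j k * z ^ j * cnj z ^ k) has_sum f z) UNIV"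
    using zero unfolding zero_at_origin_def by blast
  define r0 where "r0 = min \<epsilon> \<delta> / 2"
  have r0: "0 < r0" "r0 < \<epsilon>" "r0 < \<delta>" using \<open>\<epsilon> > 0\<close> \<open>\<delta> > 0\<close> by (auto simp: r0_def)
  define g where "g = (\<lambda>(j, k). cmod (c j k) * r0 ^ (j + k))"
  have "(\<lambda>(j, k). c j k * of_real r0 ^ j * cnj (of_real r0) ^ k) summable_on UNIV"
    using c[of "of_real r0"] r0 by (auto simp: summable_on_def)
  then have "(\<lambda>x. norm ((\<lambda>(j, k). c j k * of_real r0 ^ j * cnj (of_real r0) ^ k) x)) summable_on UNIV"
    by (subst (asm) summable_on_iff_abs_summable_on_complex)
  also have "(\<lambda>x. norm ((\<lambda>(j, k). c j k * of_real r0 ^ j * cnj (of_real r0) ^ k) x)) = g"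
    using r0 by (auto simp: g_def norm_mult norm_power power_add fun_eq_iff)
  finally have g: "(g has_sum infsum g UNIV) UNIV" by simp
  define M where "M = infsum g UNIV"
  \<comment> \<open>the orders to be killed, shifted by a + b, lie between 1 and 2 * b, so L divides none of them\<close>
  define L where "L = Suc (2 * b)"
  \<comment> \<open>terms of degree below E are killed; E = 0 by truncation if the function is unbounded (b < a)\<close>
  define E where "E = Suc b - a"
  define \<zeta> where "\<zeta> i = cis (2 * pi * real i / real L)" for i
  have norm_\<zeta>: "cmod (\<zeta> i) = 1" for i by (simp add: \<zeta>_def)
  have cnj_\<zeta>: "\<zeta> i * cnj (\<zeta> i) = 1" for i
    using complex_norm_square[of "\<zeta> i"] by (simp add: norm_\<zeta>)
  \<comment> \<open>the factor by which the weighted sum over the rotations multiplies the term of index (j, k)\<close>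
  define W where "W = (\<lambda>(j, k). (\<Sum>i<L. \<zeta> i ^ (a + b + j) * cnj (\<zeta> i) ^ k))"
  have W: "W (j, k) = 0" if "j + k < E" "a \<noteq> 0" for j k
  proof -
    have k: "k \<le> b" and e: "0 < a + b + j - k" "a + b + j - k < L"
      using that by (auto simp: E_def L_def)
    have "\<zeta> i ^ (a + b + j) * cnj (\<zeta> i) ^ k = \<zeta> i ^ (a + b + j - k)" for i
    proof -
      have "\<zeta> i ^ (a + b + j) = \<zeta> i ^ (a + b + j - k) * \<zeta> i ^ k"
        using k by (simp flip: power_add)
      then show ?thesis
        by (simp add: mult.assoc cnj_\<zeta> flip: power_mult_distrib)
    qed
    then show ?thesis
      using sum_roots_of_unity_power[OF e] by (simp add: W_def \<zeta>_def)
  qed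
  have W_bound: "cmod (W x) \<le> real L" for x
  proof -
    have "cmod (W x) \<le> (\<Sum>i<L. cmod (\<zeta> i ^ (a + b + fst x) * cnj (\<zeta> i) ^ snd x))"
      unfolding W_def by (cases x) (auto intro: norm_sum)
    also have "\<dots> = real L" by (simp add: norm_mult norm_power norm_\<zeta>)
    finally show ?thesis .
  qed
  have bound: "\<bar>S (r\<^sup>2)\<bar> \<le> M / r0 ^ E * r ^ (E + a - b)" if r: "0 < r" "r < r0" for r
  proof -
    have "((\<lambda>(j, k). W (j, k) * c j k * of_real r ^ (j + k)) has_sum
        (\<Sum>i<L. \<zeta> i ^ (a + b) * f (\<zeta> i * of_real r))) UNIV"
    proof -
      have "((\<lambda>x. \<Sum>i<L. \<zeta> i ^ (a + b) *
          (\<lambda>(j, k). c j k * (\<zeta> i * of_real r) ^ j * cnj (\<zeta> i * of_real r) ^ k) x) has_sum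
        (\<Sum>i<L. \<zeta> i ^ (a + b) * f (\<zeta> i * of_real r))) UNIV"
        using r r0 by (intro has_sum_finite_sum has_sum_cmult_right c) (auto simp: norm_mult norm_\<zeta>)
      also have "(\<lambda>x. \<Sum>i<L. \<zeta> i ^ (a + b) *
          (\<lambda>(j, k). c j k * (\<zeta> i * of_real r) ^ j * cnj (\<zeta> i * of_real r) ^ k) x) =
          (\<lambda>(j, k). W (j, k) * c j k * of_real r ^ (j + k))"
        by (auto simp: fun_eq_iff W_def sum_distrib_right sum_distrib_left power_add power_mult_distrib
            mult_ac intro!: sum.cong)
      finally show ?thesis .
    qed
    moreover have "\<zeta> i ^ (a + b) * f (\<zeta> i * of_real r) = of_real (r ^ b / r ^ a * S (r\<^sup>2))" for i
    proof -
      have "f (\<zeta> i * of_real r) = cnj (\<zeta> i) ^ b * of_real r ^ b / (\<zeta> i ^ a * of_real r ^ a) * of_real (S (r\<^sup>2))"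
        using r r0 f[of "\<zeta> i * of_real r"] by (simp add: norm_mult norm_\<zeta> power_mult_distrib)
      then have "\<zeta> i ^ (a + b) * f (\<zeta> i * of_real r) =
          (\<zeta> i ^ (a + b) * cnj (\<zeta> i) ^ b) / \<zeta> i ^ a * of_real (r ^ b / r ^ a * S (r\<^sup>2))"
        by simp
      also have "\<zeta> i ^ (a + b) * cnj (\<zeta> i) ^ b = \<zeta> i ^ a"
        by (simp add: power_add mult.assoc cnj_\<zeta> flip: power_mult_distrib)
      also have "\<zeta> i ^ a / \<zeta> i ^ a = 1" using norm_\<zeta>[of i] by auto
      finally show ?thesis by simp
    qed
    ultimately have sum: "((\<lambda>(j, k). W (j, k) * c j k * of_real r ^ (j + k)) has_sum
        of_real (real L * (r ^ b / r ^ a * S (r\<^sup>2)))) UNIV"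
      by simp
    have gs: "((\<lambda>x. real L * (r / r0) ^ E * g x) has_sum real L * (r / r0) ^ E * M) UNIV"
      unfolding M_def by (rule has_sum_cmult_right[OF g])
    have le: "norm ((\<lambda>(j, k). W (j, k) * c j k * of_real r ^ (j + k)) x) \<le>
        real L * (r / r0) ^ E * g x" for x
    proof (cases x)
      case (Pair j k)
      show ?thesis
      proof (cases "W (j, k) * c j k = 0")
        case True
        then show ?thesis using r r0 by (auto simp: Pair g_def)
      next
        case False
        have "E \<le> j + k"
        proof (cases "a = 0")
          case True
          \<comment> \<open>here the only term of degree below E is the constant one, which is zero by assumption\<close>
          then have "E = 1" using ab by (simp add: E_def)
          then show ?thesis using False c0 by (cases "j + k") auto
        next
          case a: False
          then show ?thesis using False W[of j k] by force
        qed
        then have "(r / r0) ^ (j + k) \<le> (r / r0) ^ E"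
          using r r0 by (intro power_decreasing) auto
        then have "r ^ (j + k) \<le> (r / r0) ^ E * r0 ^ (j + k)"
          using r0 by (simp add: power_divide field_simps)
        then have "cmod (W (j, k)) * (cmod (c j k) * r ^ (j + k)) \<le>
            real L * (cmod (c j k) * ((r / r0) ^ E * r0 ^ (j + k)))"
          using r by (intro mult_mono W_bound) auto
        then show ?thesis
          using r by (simp add: Pair g_def norm_mult norm_power mult_ac)
      qed
    qed
    have "norm (of_real (real L * (r ^ b / r ^ a * S (r\<^sup>2))) :: complex) \<le> real L * (r / r0) ^ E * M"
    proof -
      let ?h = "\<lambda>x. norm ((\<lambda>(j, k). W (j, k) * c j k * of_real r ^ (j + k)) x)"
      have "?h summable_on UNIV"
        using le by (intro summable_on_comparison_test[OF has_sum_imp_summable[OF gs]]) auto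
      then have h: "(?h has_sum infsum ?h UNIV) UNIV" by simp
      have "norm (of_real (real L * (r ^ b / r ^ a * S (r\<^sup>2))) :: complex) \<le> infsum ?h UNIV"
        by (rule norm_has_sum_bound[OF h sum])
      also have "\<dots> \<le> real L * (r / r0) ^ E * M"
        by (rule has_sum_mono[OF h gs]) (rule le)
      finally show ?thesis .
    qed
    then have "real L * (r ^ b / r ^ a * \<bar>S (r\<^sup>2)\<bar>) \<le> real L * ((r / r0) ^ E * M)"
      using r by (simp only: norm_of_real abs_mult) (simp add: mult_ac)
    then have "r ^ b / r ^ a * \<bar>S (r\<^sup>2)\<bar> \<le> (r / r0) ^ E * M"
      by (subst (asm) mult_le_cancel_left_pos) (auto simp: L_def)
    then have "r ^ b * \<bar>S (r\<^sup>2)\<bar> \<le> r ^ (E + a) * (M / r0 ^ E)"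
      using r r0 by (simp add: field_simps power_add)
    also have "E + a = b + (E + a - b)" by (simp add: E_def)
    finally have "r ^ b * \<bar>S (r\<^sup>2)\<bar> \<le> r ^ b * (M / r0 ^ E * r ^ (E + a - b))"
      by (simp add: power_add mult_ac)
    then show ?thesis by (subst (asm) mult_le_cancel_left_pos) (use r in auto)
  qed
  have "(\<lambda>r. M / r0 ^ E * r ^ (E + a - b)) \<midarrow>0\<rightarrow> M / r0 ^ E * 0 ^ (E + a - b)"
    by (intro tendsto_intros)
  moreover have "E + a - b > 0" by (simp add: E_def)
  ultimately have lim0: "((\<lambda>r. M / r0 ^ E * r ^ (E + a - b)) \<longlongrightarrow> 0) (at_right 0)"
    by (auto simp: filterlim_at_split power_0_left)
  have "isCont (\<lambda>r. \<bar>S (r\<^sup>2)\<bar>) 0"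
    using S by (intro continuous_intros isCont_o2[of 0 "\<lambda>r. r\<^sup>2" S]) auto
  then have limS: "((\<lambda>r. \<bar>S (r\<^sup>2)\<bar>) \<longlongrightarrow> \<bar>S 0\<bar>) (at_right 0)"
    by (auto simp: isCont_def filterlim_at_split)
  have "\<forall>\<^sub>F r in at_right 0. \<bar>S (r\<^sup>2)\<bar> \<le> M / r0 ^ E * r ^ (E + a - b)"
    unfolding eventually_at_right_field using bound r0 by blast
  then have "\<bar>S 0\<bar> \<le> 0"
    by (intro tendsto_le[OF _ lim0 limS]) auto
  then show ?thesis by simp
qed

lemma zero_at_origin_polynomial:
  assumes f: "\<And>z. 0 < cmod z \<Longrightarrow> cmod z < 1 \<Longrightarrow>
      f z = z ^ p * cnj z ^ q * of_real (poly P ((cmod z)\<^sup>2))"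
    and pq: "p + q > 0"
  shows "zero_at_origin f"
proof -
  define c :: "nat \<Rightarrow> nat \<Rightarrow> complex" where
    "c j k = (if p \<le> j \<and> k + p = j + q then of_real (coeff P (j - p)) else 0)" for j k
  define B where "B = (\<lambda>i. (p + i, q + i)) ` {..degree P}"
  have "((\<lambda>(j, k). c j k * z ^ j * cnj z ^ k) has_sum f z) UNIV"
    if z: "0 < cmod z" "cmod z < 1" for z
  proof (rule has_sum_finite_neutralI)
    show "finite B" "B \<subseteq> UNIV" by (auto simp: B_def)
    show "(\<lambda>(j, k). c j k * z ^ j * cnj z ^ k) x = 0" if "x \<in> UNIV - B" for x
    proof (cases x)
      case (Pair j k)
      have "c j k = 0"
      proof (rule ccontr)
        assume "c j k \<noteq> 0"
        then have *: "p \<le> j" "k + p = j + q" "coeff P (j - p) \<noteq> 0"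
          by (auto simp: c_def split: if_splits)
        then have "(j, k) = (p + (j - p), q + (j - p))" "j - p \<le> degree P"
          by (auto intro: le_degree)
        then show False using that unfolding B_def Pair by blast
      qed
      then show ?thesis by (simp add: Pair)
    qed
    have sq: "(complex_of_real (cmod z))\<^sup>2 = z * cnj z"
      by (metis complex_norm_square of_real_power)
    have "(\<Sum>x\<in>B. (\<lambda>(j, k). c j k * z ^ j * cnj z ^ k) x) =
        (\<Sum>i\<le>degree P. of_real (coeff P i) * z ^ (p + i) * cnj z ^ (q + i))"
      unfolding B_def by (subst sum.reindex) (auto simp: inj_on_def c_def)
    also have "\<dots> = (\<Sum>i\<le>degree P. z ^ p * cnj z ^ q * of_real (coeff P i * ((cmod z)\<^sup>2) ^ i))"
      by (intro sum.cong refl)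
         (simp add: sq power_add power_mult_distrib)
    also have "\<dots> = f z"
      unfolding f[OF z] poly_altdef by (simp add: sum_distrib_left)
    finally show "f z = (\<Sum>x\<in>B. (\<lambda>(j, k). c j k * z ^ j * cnj z ^ k) x)" by simp
  qed
  moreover have "c 0 0 = 0" using pq by (auto simp: c_def)
  ultimately show ?thesis unfolding zero_at_origin_def
    by (intro exI[of _ c] exI[of _ 1]) auto
qed

section \<open>Zeros of fractional Zernike functions\<close>

text \<open>
By Leibniz's rule every summand carries the same power of \<open>z\<close>, because the two local powers combine
into an integral power and the factors \<open>(z * cnj z) ^ k\<close> are radial. This separates the function into a
power of \<open>z\<close> and a polynomial in \<open>|z|^2\<close>, on which everything else rests.
\<close>

lemma frac_zernike_eq_radial_poly:
  assumes "0 < cmod z" "cmod z < 1"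
  shows "frac_zernike \<kappa> \<rho> m n z = z powi (n - int m) *
    of_real (fact m * poly (radial_poly m \<kappa> (of_int n + \<rho>)) ((cmod z)\<^sup>2))"
proof -
  define t where "t = (cmod z)\<^sup>2"
  define \<alpha> where "\<alpha> = of_int n + \<rho>"
  have t: "1 - t > 0" using assms by (simp add: t_def power_less_one_iff abs_square_less_1)
  have z: "z \<noteq> 0" using assms by auto
  have zz: "of_real t = z * cnj z" unfolding t_def by (rule complex_norm_square)
  have dom: "z \<in> branch_domain z" using assms z by (simp add: branch_domain_def)
  have lp: "local_power z s z = exp (of_real s * Ln z)" for s
    using z by (simp add: local_power_def)
  have powers: "local_power z (- \<rho>) z * local_power z (\<alpha> - real m + real k) z =
      z powi (n - int m) * z ^ k" for k
  proof -
    have "local_power z (- \<rho>) z * local_power z (\<alpha> - real m + real k) z =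
        exp (of_int (n - int m + int k) * Ln z)"
      unfolding lp exp_add[symmetric] by (simp add: \<alpha>_def algebra_simps)
    also have "\<dots> = exp (Ln z) powi (n - int m + int k)" by (rule exp_power_int[symmetric])
    also have "\<dots> = z powi (n - int m) * z ^ k" using z by (simp add: power_int_add)
    finally show ?thesis .
  qed
  have radii: "(1 - t) powr (- \<kappa>) * (1 - t) powr (\<kappa> + real m - real k) = (1 - t) ^ (m - k)"
    if "k \<le> m" for k
    using t that by (simp flip: powr_add powr_realpow add: of_nat_diff)
  have signs: "(-1) ^ m * (-1) ^ k * (1 - t) ^ (m - k) = (t - 1) ^ (m - k)" if "k \<le> m" for k
  proof -
    have "(-1 :: real) ^ m * (-1) ^ k = (-1) ^ (m - k)"
      using that by (simp add: power_diff_conv_inverse flip: power_add)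
    then show ?thesis by (simp flip: power_mult_distrib)
  qed
  have "(\<lambda>w. local_power z (of_int n + \<rho>) w * of_real ((1 - (cmod w)\<^sup>2) powr (\<kappa> + real m))) =
      zernike_monomial z \<alpha> (\<kappa> + real m) 0"
    by (simp add: zernike_monomial_def \<alpha>_def fun_eq_iff)
  then have "frac_zernike \<kappa> \<rho> m n z =
      (-1) ^ m * local_power z (- \<rho>) z * of_real ((1 - t) powr (- \<kappa>)) *
      (\<Sum>k\<le>m. of_real (fact m * (\<alpha> gchoose (m - k)) * ((\<kappa> + real m) gchoose k) * (-1) ^ k) *
       zernike_monomial z (\<alpha> - real m + real k) (\<kappa> + real m - real k) k z)"
    unfolding frac_zernike_def t_def by (simp only: wirtinger_dz_funpow_zernike_monomial[OF dom])
  also have "\<dots> = (\<Sum>k\<le>m. z powi (n - int m) * of_real (fact m *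
      (((\<kappa> + real m) gchoose k) * (\<alpha> gchoose (m - k)) * t ^ k * (t - 1) ^ (m - k))))"
    unfolding sum_distrib_left
  proof (intro sum.cong refl)
    fix k assume "k \<in> {..m}"
    then have k: "k \<le> m" by simp
    define C where "C = fact m * (\<alpha> gchoose (m - k)) * ((\<kappa> + real m) gchoose k)"
    have "(-1) ^ m * local_power z (- \<rho>) z * of_real ((1 - t) powr (- \<kappa>)) *
      (of_real (C * (-1) ^ k) * zernike_monomial z (\<alpha> - real m + real k) (\<kappa> + real m - real k) k z) =
      of_real (C * ((-1) ^ m * (-1) ^ k * ((1 - t) powr (- \<kappa>) * (1 - t) powr (\<kappa> + real m - real k)))) *
      (local_power z (- \<rho>) z * local_power z (\<alpha> - real m + real k) z) * cnj z ^ k"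
      unfolding zernike_monomial_def t_def by simp
    also have "\<dots> = of_real (C * (t - 1) ^ (m - k)) * z powi (n - int m) * (z * cnj z) ^ k"
      unfolding radii[OF k] powers signs[OF k] by (simp add: power_mult_distrib)
    also have "\<dots> = z powi (n - int m) * of_real (C * t ^ k * (t - 1) ^ (m - k))"
      unfolding zz[symmetric] by simp
    finally show "(-1) ^ m * local_power z (- \<rho>) z * of_real ((1 - t) powr (- \<kappa>)) *
      (of_real (fact m * (\<alpha> gchoose (m - k)) * ((\<kappa> + real m) gchoose k) * (-1) ^ k) *
       zernike_monomial z (\<alpha> - real m + real k) (\<kappa> + real m - real k) k z) =
      z powi (n - int m) * of_real (fact m *
      (((\<kappa> + real m) gchoose k) * (\<alpha> gchoose (m - k)) * t ^ k * (t - 1) ^ (m - k)))"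
      by (simp add: C_def mult_ac)
  qed
  also have "\<dots> = z powi (n - int m) * of_real (fact m * poly (radial_poly m \<kappa> \<alpha>) t)"
    by (simp only: poly_radial_poly sum_distrib_left of_real_sum)
  finally show ?thesis by (simp add: t_def \<alpha>_def)
qed

lemma radial_zeros_eq_jacobi_circles:
  assumes "\<And>t. 0 < t \<Longrightarrow> t < 1 \<Longrightarrow> P (2 * t - 1) = 0 \<longleftrightarrow> Q t = 0"
  shows "{z. 0 < cmod z \<and> cmod z < 1 \<and> Q ((cmod z)\<^sup>2) = 0} = jacobi_circles P"
proof (intro equalityI subsetI)
  fix z assume "z \<in> {z. 0 < cmod z \<and> cmod z < 1 \<and> Q ((cmod z)\<^sup>2) = 0}"
  then have z: "0 < cmod z" "cmod z < 1" "Q ((cmod z)\<^sup>2) = 0" by auto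
  define t where "t = (cmod z)\<^sup>2"
  have t: "0 < t" "t < 1" using z by (auto simp: t_def abs_square_less_1)
  then have "P (2 * t - 1) = 0" using assms z by (simp add: t_def)
  moreover have "z \<in> sphere 0 (sqrt ((1 + (2 * t - 1)) / 2))" by (simp add: t_def)
  ultimately show "z \<in> jacobi_circles P"
    using t unfolding jacobi_circles_def by (intro UN_I[of "2 * t - 1"]) auto
next
  fix z assume "z \<in> jacobi_circles P"
  then obtain r where r: "- 1 < r" "r < 1" "P r = 0" and z: "cmod z = sqrt ((1 + r) / 2)"
    by (auto simp: jacobi_circles_def)
  have sq: "(cmod z)\<^sup>2 = (1 + r) / 2" using r by (simp add: z)
  have "Q ((cmod z)\<^sup>2) = 0"
    unfolding sq using assms[of "(1 + r) / 2"] r by (simp add: field_simps)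
  moreover have "0 < cmod z" "cmod z < 1" using r by (auto simp: z)
  ultimately show "z \<in> {z. 0 < cmod z \<and> cmod z < 1 \<and> Q ((cmod z)\<^sup>2) = 0}" by simp
qed

lemma frac_zernike_zeros_eq_jacobi_circles:
  assumes "\<And>t. 0 < t \<Longrightarrow> t < 1 \<Longrightarrow>
      P (2 * t - 1) = 0 \<longleftrightarrow> poly (radial_poly m \<kappa> (of_int n + \<rho>)) t = 0"
  shows "{z. 0 < cmod z \<and> cmod z < 1 \<and> frac_zernike \<kappa> \<rho> m n z = 0} = jacobi_circles P"
proof -
  have "{z. 0 < cmod z \<and> cmod z < 1 \<and> frac_zernike \<kappa> \<rho> m n z = 0} =
      {z. 0 < cmod z \<and> cmod z < 1 \<and> poly (radial_poly m \<kappa> (of_int n + \<rho>)) ((cmod z)\<^sup>2) = 0}"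
    by (auto simp: frac_zernike_eq_radial_poly)
  then show ?thesis
    using radial_zeros_eq_jacobi_circles[of P "poly (radial_poly m \<kappa> (of_int n + \<rho>))", OF assms]
    by simp
qed

lemma zero_at_origin_frac_zernike:
  assumes "n > int m"
  shows "zero_at_origin (frac_zernike \<kappa> \<rho> m n)"
proof (rule zero_at_origin_polynomial)
  fix z assume "0 < cmod z" "cmod z < 1"
  then show "frac_zernike \<kappa> \<rho> m n z = z ^ nat (n - int m) * cnj z ^ 0 *
      of_real (poly (smult (fact m) (radial_poly m \<kappa> (of_int n + \<rho>))) ((cmod z)\<^sup>2))"
    using assms by (simp add: frac_zernike_eq_radial_poly power_int_def)
qed (use assms in simp)

text \<open>
The binomial coefficient is, up to sign, the value at \<open>0\<close> of the radial polynomial: if it does not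
vanish, nothing compensates the factor \<open>z powi (n - m)\<close>.
\<close>

lemma not_zero_at_origin_frac_zernike:
  assumes "n \<le> int m" "(of_int n + \<rho>) gchoose m \<noteq> 0"
  shows "\<not> zero_at_origin (frac_zernike \<kappa> \<rho> m n)"
proof
  define R where "R = radial_poly m \<kappa> (of_int n + \<rho>)"
  assume "zero_at_origin (frac_zernike \<kappa> \<rho> m n)"
  then have "fact m * poly R 0 = 0"
  proof (rule zero_at_origin_imp_radial_zero)
    fix z assume "0 < cmod z" "cmod z < 1"
    moreover have "z powi (n - int m) = 1 / z ^ nat (int m - n)"
      using assms by (auto simp: power_int_def field_simps)
    ultimately show "frac_zernike \<kappa> \<rho> m n z =
        cnj z ^ 0 / z ^ nat (int m - n) * of_real (fact m * poly R ((cmod z)\<^sup>2))"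
      by (simp add: frac_zernike_eq_radial_poly R_def)
  qed auto
  then show False using assms by (simp add: R_def poly_radial_poly_0)
qed

text \<open>
Here the radial polynomial vanishes at \<open>0\<close> to the order \<open>m - N\<close>. The power \<open>|z| ^ (2 * (m - N))\<close> cancels
\<open>m - N\<close> of the \<open>m - n = (m - N) + k\<close> factors \<open>1 / z\<close> and leaves \<open>cnj z ^ (m - N) / z ^ k\<close>.
\<close>

lemma zero_at_origin_frac_zernike_natural:
  assumes "\<kappa> > -1" "N < m" "n = int N - int k"
  shows "zero_at_origin (frac_zernike \<kappa> (real k) m n) \<longleftrightarrow> k = 0"
proof -
  have N: "of_int n + real k = real N" using assms by simp
  define R where "R = radial_poly N \<kappa> (real m)"
  obtain c where c: "c \<noteq> 0" "\<And>t. poly (radial_poly m \<kappa> (real N)) t = c * t ^ (m - N) * poly R t"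
    using radial_poly_factor[of \<kappa> N m] assms unfolding R_def by auto
  have f: "frac_zernike \<kappa> (real k) m n z =
      cnj z ^ (m - N) / z ^ k * of_real (poly (smult (fact m * c) R) ((cmod z)\<^sup>2))"
    if "0 < cmod z" "cmod z < 1" for z
  proof -
    have z: "z \<noteq> 0" using that by auto
    have "n - int m = - int ((m - N) + k)" using assms by simp
    then have "z powi (n - int m) = 1 / (z ^ (m - N) * z ^ k)"
      by (simp only: power_int_minus power_int_of_nat power_add inverse_eq_divide)
    moreover have "complex_of_real (((cmod z)\<^sup>2) ^ (m - N)) = z ^ (m - N) * cnj z ^ (m - N)"
      by (metis complex_norm_square of_real_power power_mult_distrib)
    ultimately show ?thesis
      using z unfolding frac_zernike_eq_radial_poly[OF that] N c
      by (simp add: field_simps del: of_real_power)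
  qed
  show ?thesis
  proof
    assume "zero_at_origin (frac_zernike \<kappa> (real k) m n)"
    show "k = 0"
    proof (rule ccontr)
      assume "k \<noteq> 0"
      have "poly (smult (fact m * c) R) 0 = 0"
        by (rule zero_at_origin_imp_radial_zero
            [OF \<open>zero_at_origin (frac_zernike \<kappa> (real k) m n)\<close> zero_less_one _ f])
           (use \<open>k \<noteq> 0\<close> in auto)
      then show False
        using c(1) assms by (simp add: R_def poly_radial_poly_0 flip: binomial_gbinomial)
    qed
  next
    assume "k = 0"
    then show "zero_at_origin (frac_zernike \<kappa> (real k) m n)"
      using f assms by (intro zero_at_origin_polynomial[where p = 0 and q = "m - N" and
          P = "smult (fact m * c) R"]) auto
  qed
qed

theorem corollary3p6:
  fixes \<kappa> \<rho> :: real and m :: nat and n :: int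
  assumes "\<kappa> > -1" and "\<rho> > -1" and "of_int n + \<rho> \<ge> 0"
  shows
    "(\<rho> \<in> \<nat> \<longrightarrow>
        (zero_at_origin (frac_zernike \<kappa> \<rho> m n) \<longleftrightarrow> n > int m \<or> (int m > n \<and> \<rho> = 0))) \<and>
     (\<rho> \<notin> \<int> \<longrightarrow>
        (zero_at_origin (frac_zernike \<kappa> \<rho> m n) \<longleftrightarrow> n > int m)) \<and>
     (\<rho> \<notin> \<int> \<longrightarrow>
        {z. 0 < cmod z \<and> cmod z < 1 \<and> frac_zernike \<kappa> \<rho> m n z = 0} =
        jacobi_circles (jacobi_poly m \<kappa> (of_int n - real m + \<rho>))) \<and>
     (\<rho> \<in> \<nat> \<longrightarrow>
        {z. 0 < cmod z \<and> cmod z < 1 \<and> frac_zernike \<kappa> \<rho> m n z = 0} =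
        jacobi_circles
          (jacobi_poly (min m (nat \<lfloor>of_int n + \<rho>\<rfloor>)) \<kappa> \<bar>of_int n - real m + \<rho>\<bar>))"
proof (intro conjI impI)
  have direct: "jacobi_poly m \<kappa> (of_int n - real m + \<rho>) (2 * t - 1) =
      poly (radial_poly m \<kappa> (of_int n + \<rho>)) t" for t
    using jacobi_poly_eq_radial_poly[OF assms(1), of m "of_int n + \<rho>" t]
    by (simp add: algebra_simps)
  {
    assume "\<rho> \<notin> \<int>"
    show "{z. 0 < cmod z \<and> cmod z < 1 \<and> frac_zernike \<kappa> \<rho> m n z = 0} =
        jacobi_circles (jacobi_poly m \<kappa> (of_int n - real m + \<rho>))"
      by (rule frac_zernike_zeros_eq_jacobi_circles) (simp add: direct)
    have "of_int n + \<rho> \<noteq> real j" for j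
    proof
      assume "of_int n + \<rho> = real j"
      then have "\<rho> = of_int (int j - n)" by simp
      then show False using \<open>\<rho> \<notin> \<int>\<close> by (metis Ints_of_int)
    qed
    then have "pochhammer (- (of_int n + \<rho>)) m \<noteq> 0"
      by (simp only: pochhammer_eq_0_iff neg_equal_iff_equal) simp
    then have "(of_int n + \<rho>) gchoose m \<noteq> 0"
      by (simp add: gbinomial_pochhammer)
    then show "zero_at_origin (frac_zernike \<kappa> \<rho> m n) \<longleftrightarrow> n > int m"
      using zero_at_origin_frac_zernike not_zero_at_origin_frac_zernike by (meson not_le)
  next
    assume "\<rho> \<in> \<nat>"
    then obtain k where k: "\<rho> = real k" by (auto elim: Nats_cases)
    define N where "N = nat (n + int k)"
    have "real_of_int (n + int k) \<ge> 0" using assms(3) k by simp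
    then have n: "n = int N - int k" unfolding N_def of_int_0_le_iff by simp
    have N: "of_int n + \<rho> = real N" and floor: "nat \<lfloor>of_int n + \<rho>\<rfloor> = N"
      using n k by simp_all
    show "zero_at_origin (frac_zernike \<kappa> \<rho> m n) \<longleftrightarrow> n > int m \<or> (int m > n \<and> \<rho> = 0)"
    proof (cases "N < m")
      case True
      then show ?thesis
        using zero_at_origin_frac_zernike_natural[OF assms(1) True n] n by (auto simp: k)
    next
      case False
      then have "(of_int n + \<rho>) gchoose m \<noteq> 0"
        unfolding N by (simp flip: binomial_gbinomial)
      then have "zero_at_origin (frac_zernike \<kappa> \<rho> m n) \<longleftrightarrow> n > int m"
        using zero_at_origin_frac_zernike not_zero_at_origin_frac_zernike by (meson not_le)
      then show ?thesis using False n k by auto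
    qed
    show "{z. 0 < cmod z \<and> cmod z < 1 \<and> frac_zernike \<kappa> \<rho> m n z = 0} =
        jacobi_circles
          (jacobi_poly (min m (nat \<lfloor>of_int n + \<rho>\<rfloor>)) \<kappa> \<bar>of_int n - real m + \<rho>\<bar>)"
    proof (rule frac_zernike_zeros_eq_jacobi_circles)
      fix t :: real assume t: "0 < t" "t < 1"
      show "jacobi_poly (min m (nat \<lfloor>of_int n + \<rho>\<rfloor>)) \<kappa> \<bar>of_int n - real m + \<rho>\<bar> (2 * t - 1) = 0
          \<longleftrightarrow> poly (radial_poly m \<kappa> (of_int n + \<rho>)) t = 0"
      proof (cases "N < m")
        case True
        then obtain c where "c \<noteq> 0" "poly (radial_poly m \<kappa> (real N)) t =
            c * t ^ (m - N) * poly (radial_poly N \<kappa> (real m)) t"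
          using radial_poly_factor[OF assms(1), of N m] by (metis less_imp_le)
        moreover have "\<bar>of_int n - real m + \<rho>\<bar> = real m - real N" using N True by simp
        ultimately show ?thesis
          using True t unfolding floor N by (simp add: jacobi_poly_eq_radial_poly[OF assms(1)])
      next
        case False
        then have "min m (nat \<lfloor>of_int n + \<rho>\<rfloor>) = m" "\<bar>of_int n - real m + \<rho>\<bar> = of_int n - real m + \<rho>"
          using N floor by auto
        then show ?thesis by (simp only: direct)
      qed
    qed
  }
qed

end
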